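(* A game is tame if and only if there exist four pairwise disjoint sets $V'_{0,1},V'_{1,0},V'_{0,0},V'_{1,1}$ of positions satisfying: (i) all four sets are independent (no move between two positions of the same set); (ii) $V'_{0,1}$ contains all terminal positions; (iii) every non-terminal $x\in V'_{0,1}$ is movable to $V'_{1,0}$ but not to $V'_{0,0}\cup V'_{1,1}$; (iv) every $x\in V'_{1,0}$ is movable to $V'_{0,1}$ but not to $V'_{0,0}\cup V'_{1,1}$; (v) no $x\in V'_{0,0}$ is movable to $V'_{0,1}\cup V'_{1,0}$; (vi) every $x\in V'_{1,1}$ is movable to $V'_{0,0}$ but not to $V'_{0,1}\cup V'_{1,0}$; (vii) every $x\notin V'_{0,1}\cup V'_{1,0}\cup V'_{0,0}$ is movable to $V'_{0,1}\cup V'_{1,0}\cup V'_{0,0}$; (viii) every position $x$ satisfies at least one of: ($\mathfrak a_0'$) $x\in V'_{0,1}\cup V'_{1,0}\cup V'_{0,0}\cup V'_{1,1}$; ($\mathfrak c'$) $x$ is movable to $V'_{0,1}$ and to $V'_{1,0}$; ($\mathfrak e'$) $x$ is movable to $V'_{0,0}$ and to $V'_{1,1}$. Moreover, whenever all these conditions hold, $V'_{0,1}=V_{0,1}$, $V'_{1,0}=V_{1,0}$, $V'_{0,0}=V_{0,0}$ and $V'_{1,1}=V_{1,1}$.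
   Context: A game is a two-player impartial game given by a directed acyclic graph whose vertices are positions and whose arcs are moves, such that from every position only finitely many positions are reachable. A position with no moves is terminal. $\operatorname{mex}(S)$ is the least non-negative integer not in $S$. The normal Sprague–Grundy function is $\mathcal{G}(x)=\operatorname{mex}\{\mathcal{G}(y): x\to y\}$ (so $0$ on terminal positions); the misère Sprague–Grundy function $\mathcal{G}^-$ satisfies $\mathcal{G}^-(x)=1$ for terminal $x$ and $\mathcal{G}^-(x)=\operatorname{mex}\{\mathcal{G}^-(y): x\to y\}$ otherwise. $V_{i,j}$ denotes the set of positions $x$ with $\mathcal{G}(x)=i$ and $\mathcal{G}^-(x)=j$. A position $x$ is movable to a set $W$ if there is a move from $x$ to some position of $W$. A game is tame if every position lies in $V_{0,1}\cup V_{1,0}\cup\bigcup_{k\ge0}V_{k,k}$. *)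

theory Defs
  imports Main
begin

locale game =
  fixes P :: "'a set" and E :: "('a \<times> 'a) set"
  assumes moves_between_positions: "E \<subseteq> P \<times> P"
    and acyclic_moves: "acyclic E"
    and finite_reachable: "\<And>x. x \<in> P \<Longrightarrow> finite (E\<^sup>* `` {x})"

definition terminal :: "('a \<times> 'a) set \<Rightarrow> 'a \<Rightarrow> bool" where
  "terminal E x \<longleftrightarrow> E `` {x} = {}"

definition movable :: "('a \<times> 'a) set \<Rightarrow> 'a \<Rightarrow> 'a set \<Rightarrow> bool" where
  "movable E x W \<longleftrightarrow> (\<exists>y\<in>W. (x, y) \<in> E)"

definition independent_set :: "('a \<times> 'a) set \<Rightarrow> 'a set \<Rightarrow> bool" where
  "independent_set E W \<longleftrightarrow> (\<forall>x\<in>W. \<forall>y\<in>W. (x, y) \<notin> E)"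

definition mex :: "nat set \<Rightarrow> nat" where
  "mex S = (LEAST n. n \<notin> S)"

(* The converse of the move relation of a game is well-founded, so these two definitions satisfy
   the usual recursion equations: see grundy_rec, misere_grundy_terminal and misere_grundy_rec. *)
definition grundy :: "('a \<times> 'a) set \<Rightarrow> 'a \<Rightarrow> nat" where
  "grundy E = wfrec (E\<inverse>) (\<lambda>g x. mex (g ` (E `` {x})))"

definition misere_grundy :: "('a \<times> 'a) set \<Rightarrow> 'a \<Rightarrow> nat" where
  "misere_grundy E =
     wfrec (E\<inverse>) (\<lambda>g x. if terminal E x then 1 else mex (g ` (E `` {x})))"

definition V :: "'a set \<Rightarrow> ('a \<times> 'a) set \<Rightarrow> nat \<Rightarrow> nat \<Rightarrow> 'a set" where
  "V P E i j = {x \<in> P. grundy E x = i \<and> misere_grundy E x = j}"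

definition tame :: "'a set \<Rightarrow> ('a \<times> 'a) set \<Rightarrow> bool" where
  "tame P E \<longleftrightarrow> (\<forall>x\<in>P. x \<in> V P E 0 1 \<union> V P E 1 0 \<union> (\<Union>k. V P E k k))"

definition tame_certificate ::
  "'a set \<Rightarrow> ('a \<times> 'a) set \<Rightarrow> 'a set \<Rightarrow> 'a set \<Rightarrow> 'a set \<Rightarrow> 'a set \<Rightarrow> bool" where
  "tame_certificate P E V01 V10 V00 V11 \<longleftrightarrow>
     V01 \<subseteq> P \<and> V10 \<subseteq> P \<and> V00 \<subseteq> P \<and> V11 \<subseteq> P \<and>
     V01 \<inter> V10 = {} \<and> V01 \<inter> V00 = {} \<and> V01 \<inter> V11 = {} \<and>
     V10 \<inter> V00 = {} \<and> V10 \<inter> V11 = {} \<and> V00 \<inter> V11 = {} \<and>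
     independent_set E V01 \<and> independent_set E V10 \<and>
     independent_set E V00 \<and> independent_set E V11 \<and>
     (\<forall>x\<in>P. terminal E x \<longrightarrow> x \<in> V01) \<and>
     (\<forall>x\<in>V01. \<not> terminal E x \<longrightarrow> movable E x V10 \<and> \<not> movable E x (V00 \<union> V11)) \<and>
     (\<forall>x\<in>V10. movable E x V01 \<and> \<not> movable E x (V00 \<union> V11)) \<and>
     (\<forall>x\<in>V00. \<not> movable E x (V01 \<union> V10)) \<and>
     (\<forall>x\<in>V11. movable E x V00 \<and> \<not> movable E x (V01 \<union> V10)) \<and>
     (\<forall>x\<in>P. x \<notin> V01 \<union> V10 \<union> V00 \<longrightarrow> movable E x (V01 \<union> V10 \<union> V00)) \<and>
     (\<forall>x\<in>P. x \<in> V01 \<union> V10 \<union> V00 \<union> V11 \<or>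
             movable E x V01 \<and> movable E x V10 \<or>
             movable E x V00 \<and> movable E x V11)"

context game
begin

lemma wf_converse_moves: "wf (E\<inverse>)"
proof (rule wfI_min)
  fix q :: 'a and Q assume q: "q \<in> Q"
  show "\<exists>z\<in>Q. \<forall>y. (y, z) \<in> E\<inverse> \<longrightarrow> y \<notin> Q"
  proof (cases "q \<in> P")
    case False
    then show ?thesis using q moves_between_positions by blast
  next
    case True
    define R where "R = E\<^sup>* `` {q}"
    define F where "F = E \<inter> R \<times> R"
    have "finite F"
      using finite_reachable[OF True] by (simp add: F_def R_def)
    moreover have "acyclic F"
      using acyclic_moves by (rule acyclic_subset) (simp add: F_def)
    ultimately have "wf (F\<inverse>)"
      by (rule finite_acyclic_wf_converse)
    moreover have "q \<in> Q \<inter> R"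
      using q by (simp add: R_def)
    ultimately obtain z where z: "z \<in> Q \<inter> R" "\<And>y. (y, z) \<in> F\<inverse> \<Longrightarrow> y \<notin> Q \<inter> R"
      by (metis wfE_min)
    have "y \<notin> Q" if "(z, y) \<in> E" for y
    proof -
      have "y \<in> R" using z(1) that by (auto simp: R_def intro: rtrancl_into_rtrancl)
      then show ?thesis using z that by (auto simp: F_def)
    qed
    then show ?thesis using z(1) by blast
  qed
qed

lemma grundy_rec: "grundy E x = mex {grundy E y | y. (x, y) \<in> E}"
proof -
  have "grundy E x = mex (cut (grundy E) (E\<inverse>) x ` (E `` {x}))"
    unfolding grundy_def by (subst wfrec[OF wf_converse_moves]) simp
  also have "cut (grundy E) (E\<inverse>) x ` (E `` {x}) = {grundy E y | y. (x, y) \<in> E}"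
    by (force simp: cut_apply)
  finally show ?thesis .
qed

lemma misere_grundy_terminal: "terminal E x \<Longrightarrow> misere_grundy E x = 1"
  unfolding misere_grundy_def by (subst wfrec[OF wf_converse_moves]) simp

lemma misere_grundy_rec:
  assumes "\<not> terminal E x"
  shows "misere_grundy E x = mex {misere_grundy E y | y. (x, y) \<in> E}"
proof -
  have "misere_grundy E x = mex (cut (misere_grundy E) (E\<inverse>) x ` (E `` {x}))"
    unfolding misere_grundy_def by (subst wfrec[OF wf_converse_moves]) (simp add: assms)
  also have "cut (misere_grundy E) (E\<inverse>) x ` (E `` {x}) = {misere_grundy E y | y. (x, y) \<in> E}"
    by (force simp: cut_apply)
  finally show ?thesis .
qed

end

end

(* Given a certificate, well-founded induction along the moves determines both Sprague-Grundy
   values: they are (0,1), (1,0), (0,0), (1,1) on the four sets and (k,k) with k >= 2 elsewhere.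
   In the last case condition (viii) puts 0 and 1 into both sets of option values, so these two
   sets coincide. Conversely, in a tame game the conditions for the sets V i j only express which
   values the mex rule forbids and which it forces among the options of a position. *)
theory Submission imports Defs begin

section \<open>Properties of \<open>mex\<close>\<close>

lemma mex_notin: "finite S \<Longrightarrow> mex S \<notin> S"
  unfolding mex_def by (rule LeastI_ex) (rule ex_new_if_finite[OF infinite_UNIV_nat])

text \<open>Finiteness of \<open>S\<close> matters only for \<open>mex\<close> to avoid
  \<open>S\<close>: whatever value \<open>LEAST\<close> takes, no smaller number can satisfy its
  predicate.\<close>

lemma less_mex_imp_mem: "n < mex S \<Longrightarrow> n \<in> S"
  unfolding mex_def using not_less_Least by blast

lemma mex_eqI: "n \<notin> S \<Longrightarrow> (\<And>m. m < n \<Longrightarrow> m \<in> S) \<Longrightarrow> mex S = n"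
  unfolding mex_def by (rule Least_equality) (auto simp: not_less[symmetric])

lemma two_le_mex:
  assumes "finite S" "0 \<in> S" "1 \<in> S"
  shows "2 \<le> mex S"
proof -
  have "mex S \<noteq> 0" "mex S \<noteq> 1"
    using mex_notin[OF assms(1)] assms(2,3) by metis+
  then show ?thesis by linarith
qed

section \<open>Values of options: what the mex rule forbids and what it forces\<close>

context game
begin

text \<open>Outside \<open>P\<close> there are no moves at all, so this and the facts built on it
  hold for every \<open>x\<close>, without a membership hypothesis.\<close>

lemma finite_moves: "finite {y. (x, y) \<in> E}"
proof (cases "x \<in> P")
  case True
  show ?thesis by (rule finite_subset[OF _ finite_reachable[OF True]]) auto
next
  case False
  then have "{y. (x, y) \<in> E} = {}" using moves_between_positions by blast
  then show ?thesis by simp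
qed

lemma finite_option_values: "finite {f y | y. (x, y) \<in> E}"
  by (rule finite_image_set[OF finite_moves])

lemma grundy_option_neq: "(x, y) \<in> E \<Longrightarrow> grundy E y \<noteq> grundy E x"
  using mex_notin[OF finite_option_values, of "grundy E" x] grundy_rec[of x] by auto

lemma less_grundyD: "n < grundy E x \<Longrightarrow> \<exists>y. (x, y) \<in> E \<and> grundy E y = n"
  using less_mex_imp_mem[of n "{grundy E y | y. (x, y) \<in> E}"] grundy_rec[of x] by auto

text \<open>The option \<open>y\<close> itself shows that \<open>x\<close> is not terminal, so the
  mex recursion applies.\<close>

lemma misere_grundy_option_neq: "(x, y) \<in> E \<Longrightarrow> misere_grundy E y \<noteq> misere_grundy E x"
  using mex_notin[OF finite_option_values, of "misere_grundy E" x] misere_grundy_rec[of x]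
  by (fastforce simp: terminal_def)

text \<open>Here non-terminality must be assumed: a terminal position has misere value 1 by
  convention, yet no option of value 0.\<close>

lemma less_misere_grundyD:
  "n < misere_grundy E x \<Longrightarrow> \<not> terminal E x \<Longrightarrow> \<exists>y. (x, y) \<in> E \<and> misere_grundy E y = n"
  using less_mex_imp_mem[of n "{misere_grundy E y | y. (x, y) \<in> E}"] misere_grundy_rec[of x]
  by auto

lemma grundy_terminal: "terminal E x \<Longrightarrow> grundy E x = 0"
  using less_grundyD[of 0 x] by (auto simp: terminal_def)

lemma grundy_eqI:
  assumes "\<And>y. (x, y) \<in> E \<Longrightarrow> grundy E y \<noteq> n"
    and "\<And>m. m < n \<Longrightarrow> \<exists>y. (x, y) \<in> E \<and> grundy E y = m"
  shows "grundy E x = n"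
  unfolding grundy_rec[of x] using assms by (intro mex_eqI) blast+

lemma misere_grundy_eqI:
  assumes "\<not> terminal E x"
    and "\<And>y. (x, y) \<in> E \<Longrightarrow> misere_grundy E y \<noteq> n"
    and "\<And>m. m < n \<Longrightarrow> \<exists>y. (x, y) \<in> E \<and> misere_grundy E y = m"
  shows "misere_grundy E x = n"
  unfolding misere_grundy_rec[OF assms(1)] using assms(2,3) by (intro mex_eqI) blast+

section \<open>From tameness to the certificate\<close>

lemma tame_cases:
  assumes "tame P E" "x \<in> P"
  obtains "grundy E x = 0" "misere_grundy E x = 1"
  | "grundy E x = 1" "misere_grundy E x = 0"
  | "misere_grundy E x = grundy E x"
  using assms by (fastforce simp: tame_def V_def)

text \<open>The only off-diagonal value pairs are (0,1) and (1,0), so fixing one coordinate to 0 or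
  1 leaves just two classes. This and its two analogues turn a value forced by mex into a move to
  one of two classes.\<close>

lemma tame_option_grundy_0:
  assumes "tame P E" "(x, y) \<in> E" "grundy E y = 0"
  shows "y \<in> V P E 0 1 \<union> V P E 0 0"
proof -
  have "y \<in> P" using assms(2) moves_between_positions by blast
  then show ?thesis using assms by (auto simp: V_def elim: tame_cases)
qed

lemma tame_option_grundy_1:
  assumes "tame P E" "(x, y) \<in> E" "grundy E y = 1"
  shows "y \<in> V P E 1 0 \<union> V P E 1 1"
proof -
  have "y \<in> P" using assms(2) moves_between_positions by blast
  then show ?thesis using assms by (auto simp: V_def elim: tame_cases)
qed

lemma tame_option_misere_grundy_0:
  assumes "tame P E" "(x, y) \<in> E" "misere_grundy E y = 0"
  shows "y \<in> V P E 1 0 \<union> V P E 0 0"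
proof -
  have "y \<in> P" using assms(2) moves_between_positions by blast
  then show ?thesis using assms by (auto simp: V_def elim: tame_cases)
qed

text \<open>Agreement in a single coordinate already rules out a move. This fact and the next yield
  every negative condition, and they also cancel one alternative in the disjunctions below.\<close>

lemma not_movable_V_grundy: "grundy E x = i \<Longrightarrow> \<not> movable E x (V P E i j)"
  by (auto simp: movable_def V_def dest: grundy_option_neq)

lemma not_movable_V_misere_grundy: "misere_grundy E x = j \<Longrightarrow> \<not> movable E x (V P E i j)"
  by (auto simp: movable_def V_def dest: misere_grundy_option_neq)

lemma movable_Un: "movable E x (A \<union> B) \<longleftrightarrow> movable E x A \<or> movable E x B"
  unfolding movable_def by blast

lemma tame_movable_grundy_pos:
  assumes "tame P E" "0 < grundy E x"
  shows "movable E x (V P E 0 1) \<or> movable E x (V P E 0 0)"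
  using less_grundyD[OF assms(2)] tame_option_grundy_0[OF assms(1)] unfolding movable_def by blast

lemma tame_movable_grundy_gt_1:
  assumes "tame P E" "1 < grundy E x"
  shows "movable E x (V P E 1 0) \<or> movable E x (V P E 1 1)"
  using less_grundyD[OF assms(2)] tame_option_grundy_1[OF assms(1)] unfolding movable_def by blast

lemma tame_movable_misere_grundy_pos:
  assumes "tame P E" "0 < misere_grundy E x" "\<not> terminal E x"
  shows "movable E x (V P E 1 0) \<or> movable E x (V P E 0 0)"
  using less_misere_grundyD[OF assms(2,3)] tame_option_misere_grundy_0[OF assms(1)]
  unfolding movable_def by blast

lemma tame_imp_certificate:
  assumes tame: "tame P E"
  shows "tame_certificate P E (V P E 0 1) (V P E 1 0) (V P E 0 0) (V P E 1 1)"
proof -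
  have indep: "independent_set E (V P E i j)" for i j
    using grundy_option_neq unfolding independent_set_def V_def by fastforce
  have terminal: "x \<in> V P E 0 1" if "x \<in> P" "terminal E x" for x
    using that by (simp add: V_def grundy_terminal misere_grundy_terminal)
  \<comment> \<open>Misere value 1 forces an option of misere value 0, hence one in
    \<open>V P E 1 0\<close> or \<open>V P E 0 0\<close>; the latter shares Grundy value 0 with
    \<open>x\<close>. The classes (1,0) and (1,1) below are treated alike, starting from Grundy
    value 1.\<close>
  have V01: "movable E x (V P E 1 0) \<and> \<not> movable E x (V P E 0 0 \<union> V P E 1 1)"
    if "x \<in> V P E 0 1" "\<not> terminal E x" for x
  proof -
    have val: "grundy E x = 0" "misere_grundy E x = 1"
      using that by (simp_all add: V_def)
    then show ?thesis
      using tame_movable_misere_grundy_pos[OF tame, of x]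
        not_movable_V_grundy[of x 0] not_movable_V_misere_grundy[of x 1]
      unfolding movable_Un by (metis that(2) zero_less_one)
  qed
  have V10: "movable E x (V P E 0 1) \<and> \<not> movable E x (V P E 0 0 \<union> V P E 1 1)"
    if "x \<in> V P E 1 0" for x
  proof -
    have val: "grundy E x = 1" "misere_grundy E x = 0"
      using that by (simp_all add: V_def)
    then show ?thesis
      using tame_movable_grundy_pos[OF tame, of x]
        not_movable_V_grundy[of x 1] not_movable_V_misere_grundy[of x 0]
      unfolding movable_Un by (metis zero_less_one)
  qed
  have V00: "\<not> movable E x (V P E 0 1 \<union> V P E 1 0)" if "x \<in> V P E 0 0" for x
  proof -
    have val: "grundy E x = 0" "misere_grundy E x = 0"
      using that by (simp_all add: V_def)
    then show ?thesis
      using not_movable_V_grundy[of x 0] not_movable_V_misere_grundy[of x 0]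
      unfolding movable_Un by blast
  qed
  have V11: "movable E x (V P E 0 0) \<and> \<not> movable E x (V P E 0 1 \<union> V P E 1 0)"
    if "x \<in> V P E 1 1" for x
  proof -
    have val: "grundy E x = 1" "misere_grundy E x = 1"
      using that by (simp_all add: V_def)
    then show ?thesis
      using tame_movable_grundy_pos[OF tame, of x]
        not_movable_V_grundy[of x 1] not_movable_V_misere_grundy[of x 1]
      unfolding movable_Un by (metis zero_less_one)
  qed
  have outside: "movable E x (V P E 0 1 \<union> V P E 1 0 \<union> V P E 0 0)"
    if "x \<in> P" "x \<notin> V P E 0 1 \<union> V P E 1 0 \<union> V P E 0 0" for x
  proof -
    \<comment> \<open>Tameness leaves only value pairs (k,k) with k \<ge> 1 outside the three
      sets.\<close>
    have "0 < grundy E x"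
      by (rule tame_cases[OF tame that(1)]) (use that in \<open>auto simp: V_def\<close>)
    then show ?thesis
      using tame_movable_grundy_pos[OF tame] by (auto simp: movable_Un)
  qed
  have all: "x \<in> V P E 0 1 \<union> V P E 1 0 \<union> V P E 0 0 \<union> V P E 1 1 \<or>
      movable E x (V P E 0 1) \<and> movable E x (V P E 1 0) \<or>
      movable E x (V P E 0 0) \<and> movable E x (V P E 1 1)"
    if x: "x \<in> P" for x
  proof (cases "x \<in> V P E 0 1 \<union> V P E 1 0 \<union> V P E 0 0 \<union> V P E 1 1")
    case False
    have eq: "misere_grundy E x = grundy E x"
      by (rule tame_cases[OF tame x]) (use False x in \<open>auto simp: V_def\<close>)
    with False x have "grundy E x \<noteq> 0" "grundy E x \<noteq> 1"
      by (auto simp: V_def)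
    then have gt: "1 < grundy E x" by linarith
    then have "\<not> terminal E x" using grundy_terminal by fastforce
    \<comment> \<open>Now \<open>x\<close> has values (k,k) with k \<ge> 2, so both mex rules force
      options of value 0 and of value 1. These are three of the four resulting disjunctions.\<close>
    then have opts: "movable E x (V P E 0 1) \<or> movable E x (V P E 0 0)"
      "movable E x (V P E 1 0) \<or> movable E x (V P E 1 1)"
      "movable E x (V P E 1 0) \<or> movable E x (V P E 0 0)"
      using gt eq tame_movable_grundy_pos[OF tame, of x] tame_movable_grundy_gt_1[OF tame, of x]
        tame_movable_misere_grundy_pos[OF tame, of x] by simp_all
    \<comment> \<open>An option of misere value 1 gives the fourth disjunction. If \<open>x\<close>
      is not movable to \<open>V P E 0 1\<close>, it is movable to both \<open>V P E 0 0\<close> and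
      \<open>V P E 1 1\<close>; the same holds if it is not movable to
      \<open>V P E 1 0\<close>.\<close>
    obtain y where y: "(x, y) \<in> E" "misere_grundy E y = 1"
      using less_misere_grundyD[of 1 x] gt eq \<open>\<not> terminal E x\<close> by auto
    then have "y \<in> P" using moves_between_positions by blast
    with y have "movable E x (V P E 0 1) \<or> movable E x (V P E 1 1)"
      using tame by (auto simp: V_def movable_def elim!: tame_cases)
    with opts show ?thesis by blast
  qed simp
  have disjoint: "V P E i j \<inter> V P E i' j' = {}" if "i \<noteq> i' \<or> j \<noteq> j'" for i j i' j'
    using that by (auto simp: V_def)
  have sub: "V P E i j \<subseteq> P" for i j by (auto simp: V_def)
  show ?thesis
    unfolding tame_certificate_def
    by (intro conjI sub indep ballI impI)
      ((rule disjoint, simp) | use terminal V01 V10 V00 V11 outside all in blast)+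
qed

section \<open>A certificate determines both Sprague-Grundy values\<close>

lemma certificate_values:
  assumes cert: "tame_certificate P E V01 V10 V00 V11" and "x \<in> P"
  shows "(x \<in> V01 \<longrightarrow> grundy E x = 0 \<and> misere_grundy E x = 1) \<and>
    (x \<in> V10 \<longrightarrow> grundy E x = 1 \<and> misere_grundy E x = 0) \<and>
    (x \<in> V00 \<longrightarrow> grundy E x = 0 \<and> misere_grundy E x = 0) \<and>
    (x \<in> V11 \<longrightarrow> grundy E x = 1 \<and> misere_grundy E x = 1) \<and>
    (x \<notin> V01 \<union> V10 \<union> V00 \<union> V11 \<longrightarrow>
       2 \<le> grundy E x \<and> misere_grundy E x = grundy E x)"
    (is "?val x")
  using \<open>x \<in> P\<close>
proof (induction x rule: wf_induct_rule[OF wf_converse_moves])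
  case (1 x)
  \<comment> \<open>The last clause of \<open>?val\<close> keeps the induction going: options
    outside the four sets have both values at least 2, so they never produce a forbidden 0 or
    1.\<close>
  have val: "?val y" if "(x, y) \<in> E" for y
    using 1 that moves_between_positions by blast
  have indep_sets: "independent_set E V01" "independent_set E V10"
    "independent_set E V00" "independent_set E V11"
    using cert by (simp_all add: tame_certificate_def)
  have indep: "\<And>y. x \<in> V01 \<Longrightarrow> (x, y) \<in> E \<Longrightarrow> y \<notin> V01"
    "\<And>y. x \<in> V10 \<Longrightarrow> (x, y) \<in> E \<Longrightarrow> y \<notin> V10"
    "\<And>y. x \<in> V00 \<Longrightarrow> (x, y) \<in> E \<Longrightarrow> y \<notin> V00"
    "\<And>y. x \<in> V11 \<Longrightarrow> (x, y) \<in> E \<Longrightarrow> y \<notin> V11"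
    using indep_sets unfolding independent_set_def by blast+
  have terminalD: "terminal E x \<Longrightarrow> x \<in> V01"
    using cert 1 unfolding tame_certificate_def by blast
  have disj: "V01 \<inter> V10 = {}" "V01 \<inter> V00 = {}" "V01 \<inter> V11 = {}"
    using cert by (simp_all add: tame_certificate_def)
  have m01: "x \<in> V01 \<Longrightarrow> \<not> terminal E x \<Longrightarrow> movable E x V10 \<and> \<not> movable E x (V00 \<union> V11)"
    and m10: "x \<in> V10 \<Longrightarrow> movable E x V01 \<and> \<not> movable E x (V00 \<union> V11)"
    and m00: "x \<in> V00 \<Longrightarrow> \<not> movable E x (V01 \<union> V10)"
    and m11: "x \<in> V11 \<Longrightarrow> movable E x V00 \<and> \<not> movable E x (V01 \<union> V10)"
    and all: "x \<in> V01 \<union> V10 \<union> V00 \<union> V11 \<or>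
      movable E x V01 \<and> movable E x V10 \<or> movable E x V00 \<and> movable E x V11"
    using cert 1 unfolding tame_certificate_def by blast+
  have c01: "grundy E x = 0 \<and> misere_grundy E x = 1" if x: "x \<in> V01"
  proof (cases "terminal E x")
    case True
    then show ?thesis by (simp add: grundy_terminal misere_grundy_terminal)
  next
    case False
    obtain z where z: "(x, z) \<in> E" "z \<in> V10"
      using m01[OF x False] by (auto simp: movable_def)
    \<comment> \<open>Among the four sets only \<open>V10\<close> remains for options: independence
      excludes \<open>V01\<close>, and the move condition excludes the other two. The next three
      classes follow the same pattern.\<close>
    have o: "y \<in> V10 \<or> y \<notin> V01 \<union> V10 \<union> V00 \<union> V11" if "(x, y) \<in> E" for y
      using m01[OF x False] indep(1)[OF x that] that by (auto simp: movable_def)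
    have "grundy E y \<noteq> 0" "misere_grundy E y \<noteq> 1" if "(x, y) \<in> E" for y
      using val[OF that] o[OF that] by auto
    with val[OF z(1)] z show ?thesis
      by (intro conjI grundy_eqI misere_grundy_eqI False) auto
  qed
  have c10: "grundy E x = 1 \<and> misere_grundy E x = 0" if x: "x \<in> V10"
  proof -
    obtain z where z: "(x, z) \<in> E" "z \<in> V01"
      using m10[OF x] by (auto simp: movable_def)
    have o: "y \<in> V01 \<or> y \<notin> V01 \<union> V10 \<union> V00 \<union> V11" if "(x, y) \<in> E" for y
      using m10[OF x] indep(2)[OF x that] that by (auto simp: movable_def)
    have "grundy E y \<noteq> 1" "misere_grundy E y \<noteq> 0" if "(x, y) \<in> E" for y
      using val[OF that] o[OF that] by auto
    with val[OF z(1)] z terminalD disj x show ?thesis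
      by (intro conjI grundy_eqI misere_grundy_eqI) auto
  qed
  have c00: "grundy E x = 0 \<and> misere_grundy E x = 0" if x: "x \<in> V00"
  proof -
    have o: "y \<in> V11 \<or> y \<notin> V01 \<union> V10 \<union> V00 \<union> V11" if "(x, y) \<in> E" for y
      using m00[OF x] indep(3)[OF x that] that by (auto simp: movable_def)
    have "grundy E y \<noteq> 0" "misere_grundy E y \<noteq> 0" if "(x, y) \<in> E" for y
      using val[OF that] o[OF that] by auto
    \<comment> \<open>No option of \<open>x\<close> is at hand here. That \<open>x\<close> is not
      terminal, without which its misere value would be 1, follows because terminal positions lie in
      \<open>V01\<close>, which is disjoint from \<open>V00\<close>.\<close>
    with terminalD disj x show ?thesis
      by (intro conjI grundy_eqI misere_grundy_eqI) auto
  qed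
  have c11: "grundy E x = 1 \<and> misere_grundy E x = 1" if x: "x \<in> V11"
  proof -
    obtain z where z: "(x, z) \<in> E" "z \<in> V00"
      using m11[OF x] by (auto simp: movable_def)
    have o: "y \<in> V00 \<or> y \<notin> V01 \<union> V10 \<union> V00 \<union> V11" if "(x, y) \<in> E" for y
      using m11[OF x] indep(4)[OF x that] that by (auto simp: movable_def)
    have "grundy E y \<noteq> 1" "misere_grundy E y \<noteq> 1" if "(x, y) \<in> E" for y
      using val[OF that] o[OF that] by auto
    with val[OF z(1)] z terminalD disj x show ?thesis
      by (intro conjI grundy_eqI misere_grundy_eqI) auto
  qed
  have ckk: "2 \<le> grundy E x \<and> misere_grundy E x = grundy E x"
    if x: "x \<notin> V01 \<union> V10 \<union> V00 \<union> V11"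
  proof -
    define G where "G = {grundy E y | y. (x, y) \<in> E}"
    define M where "M = {misere_grundy E y | y. (x, y) \<in> E}"
    \<comment> \<open>Either pair of classes in condition (viii) shows both 0 and 1 in each
      coordinate.\<close>
    obtain z w where "(x, z) \<in> E" "(x, w) \<in> E" "z \<in> V01 \<and> w \<in> V10 \<or> z \<in> V00 \<and> w \<in> V11"
      using all x by (auto simp: movable_def)
    with val[of z] val[of w] have "\<exists>y. (x, y) \<in> E \<and> grundy E y = 0"
      "\<exists>y. (x, y) \<in> E \<and> grundy E y = 1" "\<exists>y. (x, y) \<in> E \<and> misere_grundy E y = 0"
      "\<exists>y. (x, y) \<in> E \<and> misere_grundy E y = 1"
      by metis+
    then have mem: "0 \<in> G" "1 \<in> G" "0 \<in> M" "1 \<in> M"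
      unfolding G_def M_def mem_Collect_eq by metis+
    \<comment> \<open>The two values of an option can differ only by exchanging 0 and 1, and both
      numbers already belong to \<open>G\<close> and to \<open>M\<close>; hence the two sets
      coincide.\<close>
    have val': "grundy E y = misere_grundy E y \<or> grundy E y \<in> {0, 1} \<and> misere_grundy E y \<in> {0, 1}"
      if "(x, y) \<in> E" for y
      using val[OF that] by auto
    have "G \<subseteq> M"
    proof
      fix n assume "n \<in> G"
      then obtain y where y: "(x, y) \<in> E" "n = grundy E y" unfolding G_def by blast
      then have "misere_grundy E y \<in> M" unfolding M_def by blast
      with val'[OF y(1)] y(2) mem(3,4) show "n \<in> M" by auto
    qed
    moreover have "M \<subseteq> G"
    proof
      fix n assume "n \<in> M"
      then obtain y where y: "(x, y) \<in> E" "n = misere_grundy E y" unfolding M_def by blast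
      then have "grundy E y \<in> G" unfolding G_def by blast
      with val'[OF y(1)] y(2) mem(1,2) show "n \<in> G" by auto
    qed
    ultimately have "M = G" by blast
    moreover have "\<not> terminal E x" using terminalD x by blast
    ultimately have "misere_grundy E x = grundy E x"
      using grundy_rec[of x] misere_grundy_rec[of x] unfolding G_def M_def by simp
    moreover have "2 \<le> grundy E x"
      using two_le_mex[OF _ mem(1,2)] finite_option_values[of "grundy E" x] grundy_rec[of x]
      unfolding G_def by simp
    ultimately show ?thesis by blast
  qed
  from c01 c10 c00 c11 ckk show ?case by blast
qed

section \<open>Uniqueness of the certificate and the converse implication\<close>

lemma certificate_unique:
  assumes "tame_certificate P E V01 V10 V00 V11"
  shows "V01 = V P E 0 1 \<and> V10 = V P E 1 0 \<and> V00 = V P E 0 0 \<and> V11 = V P E 1 1"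
proof -
  have sub: "V01 \<subseteq> P" "V10 \<subseteq> P" "V00 \<subseteq> P" "V11 \<subseteq> P"
    using assms by (simp_all add: tame_certificate_def)
  \<comment> \<open>The value pairs of the five cases exclude each other, so the values of
    \<open>x\<close> also determine its class.\<close>
  have "(x \<in> V01 \<longleftrightarrow> grundy E x = 0 \<and> misere_grundy E x = 1) \<and>
    (x \<in> V10 \<longleftrightarrow> grundy E x = 1 \<and> misere_grundy E x = 0) \<and>
    (x \<in> V00 \<longleftrightarrow> grundy E x = 0 \<and> misere_grundy E x = 0) \<and>
    (x \<in> V11 \<longleftrightarrow> grundy E x = 1 \<and> misere_grundy E x = 1)" if "x \<in> P" for x
  proof -
    note val = certificate_values[OF assms that]
    consider "x \<in> V01" | "x \<in> V10" | "x \<in> V00" | "x \<in> V11" | "x \<notin> V01 \<union> V10 \<union> V00 \<union> V11"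
      by blast
    then show ?thesis by cases (use val in auto)
  qed
  with sub show ?thesis unfolding V_def by blast
qed

lemma certificate_imp_tame:
  assumes "tame_certificate P E V01 V10 V00 V11"
  shows "tame P E"
  unfolding tame_def
proof
  fix x assume x: "x \<in> P"
  note val = certificate_values[OF assms x]
  consider "x \<in> V01" | "x \<in> V10" | "x \<in> V00" | "x \<in> V11" | "x \<notin> V01 \<union> V10 \<union> V00 \<union> V11"
    by blast
  then show "x \<in> V P E 0 1 \<union> V P E 1 0 \<union> (\<Union>k. V P E k k)"
    by cases (use val x in \<open>auto simp: V_def\<close>)
qed

end

theorem theorem4p3:
  fixes P :: "'a set" and E :: "('a \<times> 'a) set"
  assumes "game P E"
  shows "(tame P E \<longleftrightarrow> (\<exists>V01 V10 V00 V11. tame_certificate P E V01 V10 V00 V11)) \<and>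
    (\<forall>V01 V10 V00 V11. tame_certificate P E V01 V10 V00 V11 \<longrightarrow>
       V01 = V P E 0 1 \<and> V10 = V P E 1 0 \<and> V00 = V P E 0 0 \<and> V11 = V P E 1 1)"
  using game.tame_imp_certificate[OF assms] game.certificate_imp_tame[OF assms]
    game.certificate_unique[OF assms] by blast

end
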